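(* Let $l\ge 2$ and $d_1,\ldots,d_l\ge 2$ be integers. The projective $\otimes_\pi$ and the injective $\otimes_\epsilon$ tensor products of $0$-symmetric convex bodies are continuous functions with respect to the Hausdorff distance. That is, for $\alpha=\pi$ and for $\alpha=\epsilon$, the map $$\otimes_{\alpha}:(\mathcal{B}(d_{1}),\delta^{H})\times\cdots\times(\mathcal{B}(d_{l}),\delta^{H})\rightarrow(\mathcal{B}(\otimes_{i=1}^{l}\mathbb{R}^{d_{i}}),\delta^{H}),\qquad (Q_{1},\ldots,Q_{l})\mapsto Q_{1}\otimes_{\alpha}\cdots\otimes_{\alpha}Q_{l},$$ is continuous.
   Context: $\otimes_{i=1}^l\mathbb{R}^{d_i}$ is a Euclidean space with the scalar product $\langle\cdot,\cdot\rangle_H$ determined by $\langle x^1\otimes\cdots\otimes x^l,y^1\otimes\cdots\otimes y^l\rangle_H=\prod_{i=1}^l\langle x^i,y^i\rangle$. A $0$-symmetric convex body in a finite-dimensional Euclidean space $\mathbb{E}$ is a compact convex set $Q\subset\mathbb{E}$ with nonempty interior and $Q=-Q$. $\mathcal{B}(d)$ is the set of $0$-symmetric convex bodies in $\mathbb{R}^d$, and $\mathcal{B}(\otimes_{i=1}^l\mathbb{R}^{d_i})$ is the set of those in $\otimes_{i=1}^l\mathbb{R}^{d_i}$. The polar of $Q$ is $Q^\circ=\{y\in\mathbb{E}:\sup_{x\in Q}|\langle x,y\rangle|\le 1\}$. For $Q_i\in\mathcal{B}(d_i)$: $Q_1\otimes_\pi\cdots\otimes_\pi Q_l:=\mathrm{conv}\{x^1\otimes\cdots\otimes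 x^l: x^i\in Q_i,\ i=1,\ldots,l\}$ and $Q_1\otimes_\epsilon\cdots\otimes_\epsilon Q_l:=(Q_1^\circ\otimes_\pi\cdots\otimes_\pi Q_l^\circ)^\circ$. $\delta^H$ is the Hausdorff distance: $\delta^H(P,Q)=\min\{\lambda\ge0: P\subseteq Q+\lambda B_{\mathbb{E}},\ Q\subseteq P+\lambda B_{\mathbb{E}}\}$, with $B_{\mathbb{E}}$ the closed unit ball of the ambient Euclidean space. *)

theory Defs
  imports "HOL-Analysis.Analysis"
begin

section \<open>Euclidean spaces of varying dimension\<close>

text \<open>
  The factors of the tensor product have different dimensions, so they cannot all be a type
  \<open>real ^ 'n\<close>. The space \<open>\<real>\<^sup>d\<close> is represented by the vectors of \<open>real ^ 'n\<close> supported on an index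
  set \<open>D\<close> with \<open>d\<close> elements, with the inherited scalar product. Since \<open>'n\<close> is an arbitrary finite
  type, every finite family of dimensions occurs.
\<close>

definition coord_space :: "'n::finite set \<Rightarrow> (real ^ 'n) set" where
  "coord_space D = {x. \<forall>j. j \<notin> D \<longrightarrow> x $ j = 0}"

text \<open>
  The factors are indexed by a finite type \<open>'l\<close>, and a tensor is the array of its coordinates over
  the multi-indices \<open>k :: 'l \<Rightarrow> 'n\<close>. In these coordinates the scalar product of the tensor product is
  the standard one (\<open>inner_tensor\<close> below), and \<open>tensor_space D\<close> is the span of the
  simple tensors (\<open>span_tensor\<close> below).
\<close>

definition tensor :: "('l::finite \<Rightarrow> real ^ 'n::finite) \<Rightarrow> real ^ ('l \<Rightarrow> 'n)" where
  "tensor x = (\<chi> k. \<Prod>i\<in>UNIV. x i $ k i)"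

definition tensor_space :: "('l::finite \<Rightarrow> 'n::finite set) \<Rightarrow> (real ^ ('l \<Rightarrow> 'n)) set" where
  "tensor_space D = coord_space {k. \<forall>i. k i \<in> D i}"

section \<open>Symmetric convex bodies\<close>

text \<open>
  Here and below \<open>E\<close> is the ambient Euclidean space, a linear subspace of the type; interiors,
  polars and unit balls are taken relative to it.
\<close>

definition sym_bodies :: "'a::euclidean_space set \<Rightarrow> 'a set set" where
  "sym_bodies E = {Q. Q \<subseteq> E \<and> compact Q \<and> convex Q \<and>
     (top_of_set E) interior_of Q \<noteq> {} \<and> Q = uminus ` Q}"

definition polar_in :: "'a::euclidean_space set \<Rightarrow> 'a set \<Rightarrow> 'a set" where
  "polar_in E Q = {y \<in> E. \<forall>x\<in>Q. \<bar>x \<bullet> y\<bar> \<le> 1}"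

definition proj_tensor ::
    "('l::finite \<Rightarrow> (real ^ 'n::finite) set) \<Rightarrow> (real ^ ('l \<Rightarrow> 'n)) set" where
  "proj_tensor Q = convex hull {tensor x | x. \<forall>i. x i \<in> Q i}"

definition inj_tensor ::
    "('l::finite \<Rightarrow> 'n::finite set) \<Rightarrow> ('l \<Rightarrow> (real ^ 'n) set) \<Rightarrow> (real ^ ('l \<Rightarrow> 'n)) set" where
  "inj_tensor D Q =
     polar_in (tensor_space D) (proj_tensor (\<lambda>i. polar_in (coord_space (D i)) (Q i)))"

section \<open>Hausdorff distance\<close>

definition hausdorff_radii :: "'a::euclidean_space set \<Rightarrow> 'a set \<Rightarrow> 'a set \<Rightarrow> real set" where
  "hausdorff_radii E P Q = {r. 0 \<le> r \<and>
     P \<subseteq> {q + r *\<^sub>R b | q b. q \<in> Q \<and> b \<in> cball 0 1 \<inter> E} \<and>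
     Q \<subseteq> {p + r *\<^sub>R b | p b. p \<in> P \<and> b \<in> cball 0 1 \<inter> E}}"

text \<open>
  For symmetric convex bodies the infimum is a minimum (\<open>hausdorff_attained\<close> below). The value 0 when
  there are no radii is a convention outside the bodies, needed because the locale \<open>Metric_space\<close>
  asks for nonnegativity at all arguments.
\<close>

definition hausdorff :: "'a::euclidean_space set \<Rightarrow> 'a set \<Rightarrow> 'a set \<Rightarrow> real" where
  "hausdorff E P Q =
     (if hausdorff_radii E P Q = {} then 0 else Inf (hausdorff_radii E P Q))"

definition body_topology :: "'a::euclidean_space set \<Rightarrow> 'a set topology" where
  "body_topology E = Metric_space.mtopology (sym_bodies E) (hausdorff E)"

section \<open>Adequacy of the definitions\<close>

lemma subspace_coord_space: "subspace (coord_space D)"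
  by (auto simp: coord_space_def subspace_def)

lemma dim_coord_space: "dim (coord_space D) = card D"
proof -
  have "coord_space D = {x. \<forall>i\<in>Basis. i \<notin> (\<lambda>j. axis j 1) ` D \<longrightarrow> x \<bullet> i = 0}"
    by (auto simp: coord_space_def Basis_vec_def inner_axis axis_eq_axis image_iff)
  moreover have "(\<lambda>j. axis j (1::real)) ` D \<subseteq> Basis"
    by (auto simp: Basis_vec_def)
  ultimately have "dim (coord_space D) = card ((\<lambda>j. axis j (1::real)) ` D)"
    by (simp add: dim_substandard)
  also have "\<dots> = card D"
    by (rule card_image) (auto simp: inj_on_def axis_eq_axis)
  finally show ?thesis .
qed

lemma inner_tensor: "tensor x \<bullet> tensor y = (\<Prod>i\<in>UNIV. x i \<bullet> y i)"
proof -
  have "(\<Prod>i\<in>UNIV. x i \<bullet> y i) = (\<Prod>i\<in>UNIV. \<Sum>j\<in>UNIV. x i $ j * y i $ j)"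
    by (simp add: inner_vec_def)
  also have "\<dots> = (\<Sum>k\<in>Pi\<^sub>E UNIV (\<lambda>_. UNIV). \<Prod>i\<in>UNIV. x i $ k i * y i $ k i)"
    by (rule prod_sum_PiE) auto
  also have "\<dots> = tensor x \<bullet> tensor y"
    by (simp add: tensor_def inner_vec_def prod.distrib)
  finally show ?thesis by simp
qed

lemma tensor_axis: "tensor (\<lambda>i. axis (k i) 1) = axis k 1"
proof -
  have "(\<Prod>i\<in>UNIV. axis (k i) (1::real) $ m i) = (if m = k then 1 else 0)" for m
  proof (cases "m = k")
    case True
    then show ?thesis by (simp add: axis_def)
  next
    case False
    then obtain i where "m i \<noteq> k i" by auto
    then have "axis (k i) (1::real) $ m i = 0" by (simp add: axis_def)
    then have "(\<Prod>i\<in>UNIV. axis (k i) (1::real) $ m i) = 0"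
      by (intro prod_zero) auto
    then show ?thesis using False by simp
  qed
  then show ?thesis by (simp add: tensor_def vec_eq_iff axis_def)
qed

lemma tensor_in_tensor_space:
  assumes "\<forall>i. x i \<in> coord_space (D i)"
  shows "tensor x \<in> tensor_space D"
  unfolding tensor_space_def coord_space_def mem_Collect_eq
proof (intro allI impI)
  fix k
  assume "\<not> (\<forall>i. k i \<in> D i)"
  then obtain i where "k i \<notin> D i" by auto
  then have "x i $ k i = 0" using assms by (auto simp: coord_space_def)
  then have "(\<Prod>i\<in>UNIV. x i $ k i) = 0" by (intro prod_zero) auto
  then show "tensor x $ k = 0" by (simp add: tensor_def)
qed

lemma span_tensor: "span {tensor x | x. \<forall>i. x i \<in> coord_space (D i)} = tensor_space D"
proof
  show "span {tensor x | x. \<forall>i. x i \<in> coord_space (D i)} \<subseteq> tensor_space D"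
    using tensor_in_tensor_space[of _ D]
    by (intro span_minimal) (auto simp: tensor_space_def subspace_coord_space)
  show "tensor_space D \<subseteq> span {tensor x | x. \<forall>i. x i \<in> coord_space (D i)}"
  proof
    fix t assume t: "t \<in> tensor_space D"
    have "t $ k *\<^sub>R axis k 1 \<in> span {tensor x | x. \<forall>i. x i \<in> coord_space (D i)}" for k
    proof (cases "\<forall>i. k i \<in> D i")
      case True
      then have "\<forall>i. axis (k i) 1 \<in> coord_space (D i)"
        by (auto simp: coord_space_def axis_def)
      then show ?thesis
        by (intro span_scale span_base) (auto simp: tensor_axis[symmetric])
    next
      case False
      then have "t $ k = 0" using t by (auto simp: tensor_space_def coord_space_def)
      then show ?thesis by (simp add: span_zero)
    qed
    moreover have "t = (\<Sum>k\<in>UNIV. t $ k *\<^sub>R axis k 1)"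
      by (simp add: vec_eq_iff axis_def if_distrib[of "\<lambda>z. _ * z"] cong: if_cong)
    ultimately show "t \<in> span {tensor x | x. \<forall>i. x i \<in> coord_space (D i)}"
      by (metis (no_types, lifting) span_sum)
  qed
qed

lemma dim_tensor_space: "dim (tensor_space D) = (\<Prod>i\<in>UNIV. card (D i))"
proof -
  have "{k. \<forall>i. k i \<in> D i} = Pi\<^sub>E UNIV D" by auto
  then show ?thesis
    by (simp add: tensor_space_def dim_coord_space card_PiE)
qed

lemma sym_bodies_nonempty: "Q \<in> sym_bodies E \<Longrightarrow> Q \<noteq> {}"
  using interior_of_subset by (fastforce simp: sym_bodies_def)

lemma hausdorff_radii_iff:
  assumes "subspace E" "P \<subseteq> E" "Q \<subseteq> E"
  shows "r \<in> hausdorff_radii E P Q \<longleftrightarrow>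
    0 \<le> r \<and> (\<forall>p\<in>P. \<exists>q\<in>Q. dist p q \<le> r) \<and> (\<forall>q\<in>Q. \<exists>p\<in>P. dist q p \<le> r)"
proof -
  have *: "(\<exists>b. x = y + r *\<^sub>R b \<and> b \<in> cball 0 1 \<inter> E) \<longleftrightarrow> dist x y \<le> r"
    if "0 \<le> r" "x \<in> E" "y \<in> E" for x y
  proof
    assume "\<exists>b. x = y + r *\<^sub>R b \<and> b \<in> cball 0 1 \<inter> E"
    then show "dist x y \<le> r"
      using that by (auto simp: dist_norm mult_left_le)
  next
    assume d: "dist x y \<le> r"
    show "\<exists>b. x = y + r *\<^sub>R b \<and> b \<in> cball 0 1 \<inter> E"
    proof (cases "r = 0")
      case True
      then show ?thesis using d assms(1)
        by (intro exI[of _ 0]) (auto simp: subspace_0)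
    next
      case False
      then have "0 < r" using that by simp
      then have "norm ((1/r) *\<^sub>R (x - y)) \<le> 1"
        using d by (simp add: dist_norm)
      moreover have "(1/r) *\<^sub>R (x - y) \<in> E"
        using that assms(1) by (intro subspace_scale subspace_diff)
      moreover have "x = y + r *\<^sub>R ((1/r) *\<^sub>R (x - y))"
        using False by simp
      ultimately show ?thesis
        by (intro exI[of _ "(1/r) *\<^sub>R (x - y)"]) auto
    qed
  qed
  have "P \<subseteq> {q + r *\<^sub>R b | q b. q \<in> Q \<and> b \<in> cball 0 1 \<inter> E} \<longleftrightarrow> (\<forall>p\<in>P. \<exists>q\<in>Q. dist p q \<le> r)"
    if "0 \<le> r" "P \<subseteq> E" "Q \<subseteq> E" for P Q
  proof -
    have "P \<subseteq> {q + r *\<^sub>R b | q b. q \<in> Q \<and> b \<in> cball 0 1 \<inter> E} \<longleftrightarrow>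
        (\<forall>p\<in>P. \<exists>q\<in>Q. \<exists>b. p = q + r *\<^sub>R b \<and> b \<in> cball 0 1 \<inter> E)"
      by blast
    also have "\<dots> \<longleftrightarrow> (\<forall>p\<in>P. \<exists>q\<in>Q. dist p q \<le> r)"
      using *[OF \<open>0 \<le> r\<close>] that by (meson subsetD)
    finally show ?thesis .
  qed
  then show ?thesis
    unfolding hausdorff_radii_def mem_Collect_eq using assms(2,3) by meson
qed

lemma hausdorff_radii_nonempty:
  assumes "subspace E" "P \<in> sym_bodies E" "Q \<in> sym_bodies E"
  shows "hausdorff_radii E P Q \<noteq> {}"
proof -
  have sub: "P \<subseteq> E" "Q \<subseteq> E" using assms by (auto simp: sym_bodies_def)
  obtain p q where pq: "p \<in> P" "q \<in> Q"
    using sym_bodies_nonempty assms(2,3) by (metis ex_in_conv)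
  have "bounded (P \<union> Q)" using assms by (auto simp: sym_bodies_def compact_imp_bounded)
  then obtain r where r: "\<forall>x\<in>P \<union> Q. \<forall>y\<in>P \<union> Q. dist x y \<le> r"
    using bounded_two_points by metis
  then have "dist p p \<le> r" using pq by blast
  then have "r \<in> hausdorff_radii E P Q"
    unfolding hausdorff_radii_iff[OF assms(1) sub] using r pq by auto
  then show ?thesis by auto
qed

lemma hausdorff_attained:
  assumes "subspace E" "P \<in> sym_bodies E" "Q \<in> sym_bodies E"
  shows "hausdorff E P Q \<in> hausdorff_radii E P Q"
    and "\<And>r. r \<in> hausdorff_radii E P Q \<Longrightarrow> hausdorff E P Q \<le> r"
proof -
  have sub: "P \<subseteq> E" "Q \<subseteq> E" and compact: "compact P" "compact Q"
    using assms by (auto simp: sym_bodies_def)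
  have bb: "bdd_below (hausdorff_radii E P Q)"
    by (rule bdd_belowI[of _ 0]) (simp add: hausdorff_radii_def)
  have "(\<exists>q\<in>Q. dist p q \<le> r) \<longleftrightarrow> infdist p Q \<le> r" if "compact Q" "Q \<noteq> {}" for p r and Q :: "'a set"
    using that infdist_attains_inf[of Q p] infdist_le2 by (metis compact_imp_closed)
  then have "hausdorff_radii E P Q =
      {r. 0 \<le> r \<and> (\<forall>p\<in>P. infdist p Q \<le> r) \<and> (\<forall>q\<in>Q. infdist q P \<le> r)}"
    using assms sym_bodies_nonempty[OF assms(2)] sym_bodies_nonempty[OF assms(3)]
    using hausdorff_radii_iff[OF assms(1) sub] compact by auto
  moreover have "closed {r::real. 0 \<le> r \<and> (\<forall>p\<in>P. infdist p Q \<le> r) \<and> (\<forall>q\<in>Q. infdist q P \<le> r)}"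
    unfolding Ball_def
    by (intro closed_Collect_conj closed_Collect_all closed_Collect_imp open_Collect_const
        closed_Collect_le continuous_intros)
  ultimately have "closed (hausdorff_radii E P Q)" by simp
  then show "hausdorff E P Q \<in> hausdorff_radii E P Q"
    using closed_contains_Inf[OF hausdorff_radii_nonempty[OF assms] bb]
      hausdorff_radii_nonempty[OF assms] by (simp add: hausdorff_def)
  show "\<And>r. r \<in> hausdorff_radii E P Q \<Longrightarrow> hausdorff E P Q \<le> r"
    using bb by (auto simp: hausdorff_def intro: cInf_lower)
qed

lemma Metric_space_sym_bodies:
  assumes "subspace E"
  shows "Metric_space (sym_bodies E) (hausdorff E)"
proof
  show "0 \<le> hausdorff E P Q" for P Q
    unfolding hausdorff_def by (auto intro: cInf_greatest simp: hausdorff_radii_def)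
  show "hausdorff E P Q = hausdorff E Q P" for P Q
  proof -
    have "hausdorff_radii E P Q = hausdorff_radii E Q P"
      unfolding hausdorff_radii_def by blast
    then show ?thesis by (simp add: hausdorff_def)
  qed
next
  fix P Q assume PQ: "P \<in> sym_bodies E" "Q \<in> sym_bodies E"
  then have sub: "P \<subseteq> E" "Q \<subseteq> E" by (auto simp: sym_bodies_def)
  show "hausdorff E P Q = 0 \<longleftrightarrow> P = Q"
  proof
    assume "hausdorff E P Q = 0"
    then have "0 \<in> hausdorff_radii E P Q"
      using hausdorff_attained(1)[OF assms PQ] by simp
    then show "P = Q" using hausdorff_radii_iff[OF assms sub] by auto
  next
    assume "P = Q"
    then have "0 \<in> hausdorff_radii E P Q"
      using hausdorff_radii_iff[OF assms sub] by auto
    then have "hausdorff E P Q \<le> 0" using hausdorff_attained(2)[OF assms PQ] by simp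
    moreover have "0 \<le> hausdorff E P Q"
      using hausdorff_attained(1)[OF assms PQ] by (simp add: hausdorff_radii_def)
    ultimately show "hausdorff E P Q = 0" by simp
  qed
next
  fix P Q R
  assume *: "P \<in> sym_bodies E" "Q \<in> sym_bodies E" "R \<in> sym_bodies E"
  then have sub: "P \<subseteq> E" "Q \<subseteq> E" "R \<subseteq> E" by (auto simp: sym_bodies_def)
  have 1: "hausdorff E P Q \<in> hausdorff_radii E P Q" "hausdorff E Q R \<in> hausdorff_radii E Q R"
    using * hausdorff_attained(1)[OF assms] by auto
  have tri: "\<exists>z\<in>C. dist x z \<le> a + b"
    if "\<forall>x\<in>A. \<exists>y\<in>B. dist x y \<le> a" "\<forall>y\<in>B. \<exists>z\<in>C. dist y z \<le> b" "x \<in> A"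
    for A B C :: "'a set" and a b x
    using that by (meson add_mono dist_triangle order_trans)
  have "hausdorff E P Q + hausdorff E Q R \<in> hausdorff_radii E P R"
    using 1 hausdorff_radii_iff[OF assms] sub
      tri[of P Q "hausdorff E P Q" R "hausdorff E Q R"]
      tri[of R Q "hausdorff E Q R" P "hausdorff E P Q"]
    by (simp add: add.commute)
  then show "hausdorff E P R \<le> hausdorff E P Q + hausdorff E Q R"
    using hausdorff_attained(2)[OF assms *(1,3)] by simp
qed

end

theory Submission
  imports Defs
begin

text \<open>
  A simple tensor depends uniformly continuously on its factors as long as these stay in a bounded
  set, and passing to convex hulls preserves an estimate of the Hausdorff distance; this gives the
  projective product. The polar is a continuous map on bodies: if \<open>Q\<close> contains the ball of radius
  \<open>r\<close> and \<open>P\<close> is within \<open>t r\<close> of \<open>Q\<close>, then \<open>P\<^sup>\<circ>\<close> and \<open>Q\<^sup>\<circ>\<close> agree up to factors \<open>1 + t\<close> and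
  \<open>1 / (1 - t)\<close>, and \<open>Q\<^sup>\<circ>\<close> lies in the ball of radius \<open>1 / r\<close>. The injective product is a composition of
  polars with the projective product.
\<close>

section \<open>Symmetric convex bodies and the Hausdorff distance\<close>

lemma topspace_body_topology:
  "subspace E \<Longrightarrow> topspace (body_topology E) = sym_bodies E"
  unfolding body_topology_def
  by (rule Metric_space.topspace_mtopology[OF Metric_space_sym_bodies])

lemma hausdorff_leI:
  assumes "subspace E" "P \<in> sym_bodies E" "Q \<in> sym_bodies E" "0 \<le> r"
    and "\<And>p. p \<in> P \<Longrightarrow> \<exists>q\<in>Q. dist p q \<le> r" "\<And>q. q \<in> Q \<Longrightarrow> \<exists>p\<in>P. dist q p \<le> r"
  shows "hausdorff E P Q \<le> r"
proof -
  have "P \<subseteq> E" "Q \<subseteq> E" using assms by (auto simp: sym_bodies_def)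
  then have "r \<in> hausdorff_radii E P Q"
    using assms by (simp add: hausdorff_radii_iff)
  then show ?thesis by (rule hausdorff_attained(2)[OF assms(1-3)])
qed

text \<open>The infimum is attained, so an upper bound \<open>r\<close> on the distance yields
  points within exactly \<open>r\<close>, with no extra slack.\<close>

lemma hausdorff_leD:
  assumes "subspace E" "P \<in> sym_bodies E" "Q \<in> sym_bodies E" "hausdorff E P Q \<le> r"
  shows "p \<in> P \<Longrightarrow> \<exists>q\<in>Q. dist p q \<le> r" "q \<in> Q \<Longrightarrow> \<exists>p\<in>P. dist q p \<le> r"
proof -
  have "P \<subseteq> E" "Q \<subseteq> E" using assms by (auto simp: sym_bodies_def)
  then have "(\<forall>p\<in>P. \<exists>q\<in>Q. dist p q \<le> hausdorff E P Q) \<and> (\<forall>q\<in>Q. \<exists>p\<in>P. dist q p \<le> hausdorff E P Q)"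
    using hausdorff_attained(1)[OF assms(1-3)] assms(1) by (simp add: hausdorff_radii_iff)
  then show "p \<in> P \<Longrightarrow> \<exists>q\<in>Q. dist p q \<le> r" "q \<in> Q \<Longrightarrow> \<exists>p\<in>P. dist q p \<le> r"
    using assms(4) by (meson order_trans)+
qed

lemma sym_bodies_uminus: "Q \<in> sym_bodies E \<Longrightarrow> x \<in> Q \<Longrightarrow> - x \<in> Q"
  by (auto simp: sym_bodies_def)

text \<open>By symmetry and convexity, a relative ball around some point \<open>x\<close> of
  \<open>Q\<close> can be moved to the origin by averaging it with \<open>- x\<close>.\<close>

lemma sym_bodies_inner_ball:
  assumes "subspace E" "Q \<in> sym_bodies E"
  obtains r where "0 < r" "cball 0 r \<inter> E \<subseteq> Q"
proof -
  have conv: "convex Q" using assms by (simp add: sym_bodies_def)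
  obtain x U where U: "openin (top_of_set E) U" "x \<in> U" "U \<subseteq> Q"
    using assms(2) unfolding sym_bodies_def interior_of_def by blast
  then have xE: "x \<in> E" using openin_imp_subset by blast
  obtain e where e: "0 < e" "ball x e \<inter> E \<subseteq> U"
    using U unfolding openin_contains_ball by blast
  \<comment> \<open>\<open>z\<close> is the midpoint of \<open>x + 2 z\<close> and
    \<open>- x\<close>; radius \<open>e / 4\<close> keeps \<open>x + 2 z\<close> within
    \<open>e / 2\<close> of \<open>x\<close>, hence inside the open ball.\<close>
  have "z \<in> Q" if "z \<in> cball 0 (e / 4) \<inter> E" for z
  proof -
    have "x + 2 *\<^sub>R z \<in> E" using that xE assms(1) by (simp add: subspace_add subspace_scale)
    moreover have "dist x (x + 2 *\<^sub>R z) < e" using that e(1) by (simp add: dist_norm)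
    ultimately have "x + 2 *\<^sub>R z \<in> Q" using e(2) U(3) by auto
    moreover have "- x \<in> Q" using U sym_bodies_uminus[OF assms(2)] by blast
    ultimately have "(1/2) *\<^sub>R (x + 2 *\<^sub>R z) + (1/2) *\<^sub>R (- x) \<in> Q"
      using conv by (intro convexD) auto
    then show ?thesis by (simp add: algebra_simps)
  qed
  then have "cball 0 (e / 4) \<inter> E \<subseteq> Q" by blast
  then show thesis using that[of "e / 4"] e(1) by simp
qed

lemma sym_bodies_0:
  assumes "subspace E" "Q \<in> sym_bodies E"
  shows "0 \<in> Q"
proof -
  obtain r where "0 < r" "cball 0 r \<inter> E \<subseteq> Q" using sym_bodies_inner_ball[OF assms] .
  then show ?thesis using subspace_0[OF assms(1)] by auto
qed

text \<open>A nonempty convex set has interior points relative to its affine hull, so no interior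
  point has to be exhibited: it is enough that this hull is \<open>E\<close>.\<close>

lemma sym_bodiesI:
  assumes "Q \<subseteq> E" "compact Q" "convex Q" "\<And>x. x \<in> Q \<Longrightarrow> - x \<in> Q"
    and "Q \<noteq> {}" "affine hull Q = E"
  shows "Q \<in> sym_bodies E"
proof -
  have "rel_interior Q \<noteq> {}" using assms rel_interior_eq_empty by blast
  then have "(top_of_set E) interior_of Q \<noteq> {}"
    unfolding rel_interior_def interior_of_def using assms(6) by blast
  moreover have "Q = uminus ` Q"
    using assms(4) by (force simp: image_iff)
  ultimately show ?thesis using assms by (simp add: sym_bodies_def)
qed

section \<open>Continuity of the polar\<close>

lemma polar_in_norm_le:
  assumes "subspace E" "0 < r" "cball 0 r \<inter> E \<subseteq> Q" "y \<in> polar_in E Q"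
  shows "norm y \<le> 1 / r"
proof (cases "y = 0")
  case False
  \<comment> \<open>The point of norm \<open>r\<close> in the direction of \<open>y\<close> lies in
    \<open>Q\<close> and pairs with \<open>y\<close> to \<open>r * norm y\<close>.\<close>
  let ?z = "(r / norm y) *\<^sub>R y"
  have "?z \<in> Q" using assms by (auto simp: polar_in_def subspace_scale)
  then have "\<bar>?z \<bullet> y\<bar> \<le> 1" using assms(4) by (auto simp: polar_in_def)
  moreover have "?z \<bullet> y = r * norm y"
    by (simp add: power2_norm_eq_inner[symmetric] power2_eq_square)
  ultimately have "r * norm y \<le> 1" by linarith
  then show ?thesis using assms(2) by (simp add: field_simps)
qed (use assms in auto)

text \<open>Polarity exchanges the two size conditions: the ball inside \<open>Q\<close> bounds the
  polar, and the boundedness of \<open>Q\<close> makes the polar span \<open>E\<close>. Closedness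
  comes from writing the polar as an intersection of slabs.\<close>

lemma polar_in_sym_bodies:
  assumes E: "subspace E" and Q: "Q \<in> sym_bodies E"
  shows "polar_in E Q \<in> sym_bodies E"
proof (rule sym_bodiesI)
  show sub: "polar_in E Q \<subseteq> E" by (auto simp: polar_in_def)
  obtain r where r: "0 < r" "cball 0 r \<inter> E \<subseteq> Q" using sym_bodies_inner_ball[OF E Q] .
  have "bounded (polar_in E Q)"
    using polar_in_norm_le[OF E r] by (auto simp: bounded_iff)
  moreover have "polar_in E Q = E \<inter> (\<Inter>x\<in>Q. {y. \<bar>x \<bullet> y\<bar> \<le> 1})"
    by (auto simp: polar_in_def)
  then have "closed (polar_in E Q)"
    using closed_subspace[OF E]
    by (auto intro!: closed_Collect_le continuous_intros)
  ultimately show "compact (polar_in E Q)" by (simp add: compact_eq_bounded_closed)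
  show "convex (polar_in E Q)"
  proof (rule convexI)
    fix u v :: real and a b
    assume *: "a \<in> polar_in E Q" "b \<in> polar_in E Q" "0 \<le> u" "0 \<le> v" "u + v = 1"
    have "\<bar>x \<bullet> (u *\<^sub>R a + v *\<^sub>R b)\<bar> \<le> 1" if "x \<in> Q" for x
    proof -
      have "\<bar>x \<bullet> (u *\<^sub>R a + v *\<^sub>R b)\<bar> \<le> u * \<bar>x \<bullet> a\<bar> + v * \<bar>x \<bullet> b\<bar>"
        using * by (simp add: inner_right_distrib order_trans[OF abs_triangle_ineq] abs_mult)
      also have "\<dots> \<le> u * 1 + v * 1"
        using * that by (intro add_mono mult_left_mono) (auto simp: polar_in_def)
      finally show ?thesis using * by simp
    qed
    then show "u *\<^sub>R a + v *\<^sub>R b \<in> polar_in E Q"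
      using * E by (auto simp: polar_in_def subspace_add subspace_scale)
  qed
  show "- x \<in> polar_in E Q" if "x \<in> polar_in E Q" for x
    using that E by (auto simp: polar_in_def subspace_neg)
  have 0: "0 \<in> polar_in E Q" using E by (simp add: polar_in_def subspace_0)
  then show "polar_in E Q \<noteq> {}" by blast
  have "bounded Q" using Q by (simp add: sym_bodies_def compact_imp_bounded)
  then obtain R where R: "0 < R" "\<And>x. x \<in> Q \<Longrightarrow> norm x \<le> R"
    by (auto simp: bounded_pos)
  have "E \<subseteq> span (polar_in E Q)"
  proof
    fix y assume y: "y \<in> E"
    \<comment> \<open>This factor shrinks \<open>y\<close> into the polar, by Cauchy-Schwarz and
      \<open>norm x \<le> R\<close> on \<open>Q\<close>; the \<open>+ 1\<close> covers
      \<open>y = 0\<close>.\<close>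
    define c where "c = 1 / (R * (norm y + 1))"
    have c: "0 < c" using R(1) by (simp add: c_def add_nonneg_pos)
    have "\<bar>x \<bullet> (c *\<^sub>R y)\<bar> \<le> 1" if "x \<in> Q" for x
    proof -
      have "\<bar>x \<bullet> (c *\<^sub>R y)\<bar> \<le> c * (norm x * norm y)"
        using c Cauchy_Schwarz_ineq2[of x y] by (simp add: abs_mult)
      also have "\<dots> \<le> c * (R * (norm y + 1))"
        using c R(2)[OF that] R(1) by (intro mult_left_mono mult_mono) auto
      also have "\<dots> = 1" using R(1) by (simp add: c_def add_nonneg_eq_0_iff)
      finally show ?thesis .
    qed
    then have "c *\<^sub>R y \<in> span (polar_in E Q)"
      using y E by (intro span_base) (simp add: polar_in_def subspace_scale)
    then have "(1 / c) *\<^sub>R (c *\<^sub>R y) \<in> span (polar_in E Q)" by (rule span_scale)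
    then show "y \<in> span (polar_in E Q)" using c by simp
  qed
  \<comment> \<open>Since the polar contains 0, its affine hull is its span.\<close>
  moreover have "span (polar_in E Q) \<subseteq> E" using sub E by (rule span_minimal)
  ultimately show "affine hull polar_in E Q = E"
    using affine_hull_span_0[OF hull_inc[OF 0]] by simp
qed

text \<open>
  If the points of \<open>P\<close> are within \<open>t r\<close> of \<open>Q\<close>, then \<open>P \<subseteq> (1 + t) Q\<close>, hence
  \<open>Q\<^sup>\<circ> \<subseteq> (1 + t) P\<^sup>\<circ>\<close>.
\<close>
lemma polar_in_perturb_outer:
  assumes E: "subspace E" and "0 < r" "cball 0 r \<inter> E \<subseteq> Q" "0 \<le> t" "P \<subseteq> E" "Q \<subseteq> E"
    and near: "\<And>p. p \<in> P \<Longrightarrow> \<exists>q\<in>Q. dist p q \<le> t * r"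
    and y: "y \<in> polar_in E Q"
  shows "(1 / (1 + t)) *\<^sub>R y \<in> polar_in E P"
proof -
  have "\<bar>p \<bullet> y\<bar> \<le> 1 + t" if p: "p \<in> P" for p
  proof -
    obtain q where q: "q \<in> Q" "dist p q \<le> t * r" using near[OF p] by blast
    \<comment> \<open>The error \<open>p - q\<close> is paired directly with \<open>y\<close>, whose
      norm is at most \<open>1 / r\<close>. Measuring distances in units of \<open>r\<close> makes
      the radius cancel.\<close>
    have "\<bar>(p - q) \<bullet> y\<bar> \<le> (t * r) * (1 / r)"
      using Cauchy_Schwarz_ineq2[of "p - q" y] polar_in_norm_le[OF E assms(2,3) y] q(2) assms(2,4)
      by (elim order_trans, intro mult_mono) (auto simp: dist_norm)
    then have "\<bar>(p - q) \<bullet> y\<bar> \<le> t" using assms(2) by simp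
    moreover have "\<bar>q \<bullet> y\<bar> \<le> 1" using y q(1) by (simp add: polar_in_def)
    moreover have "p \<bullet> y = q \<bullet> y + (p - q) \<bullet> y" by (simp add: inner_diff_left)
    ultimately show ?thesis by linarith
  qed
  then show ?thesis
    using y E assms(4) by (auto simp: polar_in_def subspace_scale abs_mult field_simps)
qed

text \<open>
  Conversely, if the points of \<open>Q\<close> are within \<open>t r\<close> of \<open>P\<close>, then the maximum \<open>s\<close> of
  \<open>\<bar>\<langle>\<cdot>, y\<rangle>\<bar>\<close> on \<open>Q\<close> satisfies \<open>s \<le> 1 + t s\<close> for \<open>y \<in> P\<^sup>\<circ>\<close>, because \<open>r \<bar>y\<bar> \<le> s\<close>.
\<close>
lemma polar_in_perturb_inner:
  assumes E: "subspace E" and "0 < r" "cball 0 r \<inter> E \<subseteq> Q" "0 \<le> t" "t < 1"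
    and "compact Q"
    and near: "\<And>q. q \<in> Q \<Longrightarrow> \<exists>p\<in>P. dist q p \<le> t * r"
    and y: "y \<in> polar_in E P"
  shows "(1 - t) *\<^sub>R y \<in> polar_in E Q"
proof -
  have yE: "y \<in> E" using y by (simp add: polar_in_def)
  have "0 \<in> Q" using assms(2,3) subspace_0[OF E] by auto
  then have "\<exists>m\<in>Q. \<forall>x\<in>Q. \<bar>x \<bullet> y\<bar> \<le> \<bar>m \<bullet> y\<bar>"
    using assms(6) by (intro continuous_attains_sup continuous_intros) auto
  then obtain m where m: "m \<in> Q" "\<And>x. x \<in> Q \<Longrightarrow> \<bar>x \<bullet> y\<bar> \<le> \<bar>m \<bullet> y\<bar>" by blast
  have "r * norm y \<le> \<bar>m \<bullet> y\<bar>"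
  proof (cases "y = 0")
    case False
    have "(r / norm y) *\<^sub>R y \<in> Q"
      using assms(2,3) yE E by (auto simp: subspace_scale)
    from m(2)[OF this] show ?thesis
      using assms(2) False
      by (simp add: power2_norm_eq_inner[symmetric] power2_eq_square abs_mult)
  qed simp
  moreover obtain p where p: "p \<in> P" "dist m p \<le> t * r" using near[OF m(1)] by blast
  have "\<bar>(m - p) \<bullet> y\<bar> \<le> (t * r) * norm y"
    using Cauchy_Schwarz_ineq2[of "m - p" y] p(2)
    by (elim order_trans, intro mult_right_mono) (auto simp: dist_norm)
  moreover have "\<bar>p \<bullet> y\<bar> \<le> 1" using y p(1) by (simp add: polar_in_def)
  moreover have "m \<bullet> y = p \<bullet> y + (m - p) \<bullet> y" by (simp add: inner_diff_left)
  ultimately have "\<bar>m \<bullet> y\<bar> \<le> 1 + t * \<bar>m \<bullet> y\<bar>"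
    using mult_left_mono[of "r * norm y" "\<bar>m \<bullet> y\<bar>" t] assms(4) by (simp add: mult.assoc)
  then have "(1 - t) * \<bar>m \<bullet> y\<bar> \<le> 1" by (simp add: algebra_simps)
  then have "(1 - t) * \<bar>x \<bullet> y\<bar> \<le> 1" if "x \<in> Q" for x
    using mult_left_mono[OF m(2)[OF that], of "1 - t"] assms(5) by linarith
  then show ?thesis
    using yE E assms(5) by (simp add: polar_in_def subspace_scale abs_mult)
qed

text \<open>The two perturbation estimates supply the nearby points, both multiples of
  \<open>y\<close>. Each moves \<open>y\<close> by at most \<open>t * norm y\<close>, so only norm
  bounds on the two polars remain.\<close>

lemma hausdorff_polar_in_le:
  assumes E: "subspace E" and PQ: "P \<in> sym_bodies E" "Q \<in> sym_bodies E"
    and r: "0 < r" "cball 0 r \<inter> E \<subseteq> Q" and t: "0 \<le> t" "t \<le> 1 / 2"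
    and h: "hausdorff E Q P \<le> t * r"
  shows "hausdorff E (polar_in E Q) (polar_in E P) \<le> 2 * t / r"
proof (rule hausdorff_leI)
  note near = hausdorff_leD[OF E PQ(2,1) h]
  have sub: "P \<subseteq> E" "Q \<subseteq> E" and comp: "compact Q" using PQ by (auto simp: sym_bodies_def)
  show "\<exists>q\<in>polar_in E P. dist y q \<le> 2 * t / r" if y: "y \<in> polar_in E Q" for y
  proof
    show "(1 / (1 + t)) *\<^sub>R y \<in> polar_in E P"
      using polar_in_perturb_outer[OF E r t(1) sub near(2) y] .
    have "y - (1 / (1 + t)) *\<^sub>R y = (t / (1 + t)) *\<^sub>R y"
    proof -
      have "1 - 1 / (1 + t) = t / (1 + t)" using t by (simp add: field_simps)
      then show ?thesis by (metis scaleR_left_diff_distrib scaleR_one)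
    qed
    then have "dist y ((1 / (1 + t)) *\<^sub>R y) = t / (1 + t) * norm y"
      using t by (simp add: dist_norm)
    \<comment> \<open>The factor 2 is generous here; it is chosen to agree with the bound in the
      other direction.\<close>
    also have "\<dots> \<le> (2 * t) * (1 / r)"
      using t r polar_in_norm_le[OF E r y]
      by (intro mult_mono) (auto simp: field_simps)
    finally show "dist y ((1 / (1 + t)) *\<^sub>R y) \<le> 2 * t / r" by simp
  qed
  show "\<exists>q\<in>polar_in E Q. dist y q \<le> 2 * t / r" if y: "y \<in> polar_in E P" for y
  proof
    show *: "(1 - t) *\<^sub>R y \<in> polar_in E Q"
      using polar_in_perturb_inner[OF E r t(1) _ comp near(1) y] t by simp
    \<comment> \<open>Only \<open>Q\<close> is known to contain the ball, so the norm bound on the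
      polar of \<open>P\<close> passes through the rescaled point in the polar of \<open>Q\<close>;
      \<open>t \<le> 1 / 2\<close> then costs a factor 2.\<close>
    have "(1 - t) * norm y \<le> 1 / r"
      using polar_in_norm_le[OF E r *] t by simp
    moreover have "(1 / 2) * norm y \<le> (1 - t) * norm y"
      using t by (intro mult_right_mono) auto
    ultimately have "norm y \<le> 2 / r" by simp
    moreover have "y - (1 - t) *\<^sub>R y = t *\<^sub>R y" by (simp add: algebra_simps)
    then have "dist y ((1 - t) *\<^sub>R y) = t * norm y" using t by (simp add: dist_norm)
    ultimately show "dist y ((1 - t) *\<^sub>R y) \<le> 2 * t / r"
      using mult_left_mono[of "norm y" "2 / r" t] t by (simp add: mult.commute)
  qed
qed (use E PQ t r polar_in_sym_bodies in auto)

lemma continuous_map_polar_in: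
  assumes E: "subspace E"
  shows "continuous_map (body_topology E) (body_topology E) (polar_in E)"
proof -
  interpret Metric_space "sym_bodies E" "hausdorff E" by (rule Metric_space_sym_bodies[OF E])
  show ?thesis
    unfolding body_topology_def continuous_map_to_metric topspace_mtopology
  proof (intro ballI allI impI)
    fix Q and \<epsilon> :: real assume Q: "Q \<in> sym_bodies E" and \<epsilon>: "0 < \<epsilon>"
    obtain r where r: "0 < r" "cball 0 r \<inter> E \<subseteq> Q" using sym_bodies_inner_ball[OF E Q] .
    \<comment> \<open>The cap 1/2 is what the polar estimate requires; the other term makes its
      bound \<open>2 * t / r\<close> at most \<open>\<epsilon> / 2\<close>.\<close>
    define t where "t = min (1 / 2) (\<epsilon> * r / 4)"
    have t: "0 < t" "t \<le> 1 / 2" "2 * t / r < \<epsilon>"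
      using \<epsilon> r(1) by (auto simp: t_def min_def field_simps)
    have "polar_in E P \<in> mball (polar_in E Q) \<epsilon>" if "P \<in> mball Q (t * r)" for P
    proof -
      have P: "P \<in> sym_bodies E" "hausdorff E Q P \<le> t * r" using that by auto
      from hausdorff_polar_in_le[OF E P(1) Q r _ t(2) P(2)] t(1,3)
      show ?thesis using polar_in_sym_bodies[OF E] P(1) Q by auto
    qed
    moreover have "Q \<in> mball Q (t * r)" using Q t(1) r(1) by (intro centre_in_mball_iff[THEN iffD2]) simp
    ultimately show "\<exists>U. openin mtopology U \<and> Q \<in> U \<and> (\<forall>y\<in>U. polar_in E y \<in> mball (polar_in E Q) \<epsilon>)"
      by (intro exI[of _ "mball Q (t * r)"] conjI ballI openin_mball) blast+
  qed
qed

section \<open>Continuity of the projective tensor product\<close>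

text \<open>Families of factors are packed into vectors of vectors, a Euclidean space, so that
  compactness and uniform continuity can be applied to \<open>tensor\<close>.\<close>

lemma continuous_on_tensor_vec_nth: "continuous_on S (\<lambda>v. tensor (($) v))"
  unfolding tensor_def by (intro continuous_intros)

lemma norm_le_sum_norm_vec_nth:
  fixes v :: "('a::real_normed_vector) ^ 'l"
  shows "norm v \<le> (\<Sum>i\<in>UNIV. norm (v $ i))"
  unfolding norm_vec_def by (rule L2_set_le_sum) simp

lemma compact_vec_Collect:
  fixes S :: "'l::finite \<Rightarrow> 'a::euclidean_space set"
  assumes "\<And>i. compact (S i)"
  shows "compact {v. \<forall>i. v $ i \<in> S i}"
proof -
  have "\<exists>R. \<forall>x\<in>S i. norm x \<le> R" for i
    using assms[of i] compact_imp_bounded bounded_iff by metis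
  then obtain R where R: "\<And>i x. x \<in> S i \<Longrightarrow> norm x \<le> R i" by metis
  have "norm v \<le> (\<Sum>i\<in>UNIV. R i)" if "\<forall>i. v $ i \<in> S i" for v
    using that R by (intro order_trans[OF norm_le_sum_norm_vec_nth] sum_mono) auto
  then have "bounded {v. \<forall>i. v $ i \<in> S i}" by (auto simp: bounded_iff)
  moreover have "closed {v. \<forall>i. v $ i \<in> S i}"
  proof -
    have "closed ((\<lambda>v. v $ i) -` S i)" for i
      using assms[of i] by (intro closed_vimage compact_imp_closed continuous_intros) auto
    moreover have "{v. \<forall>i. v $ i \<in> S i} = (\<Inter>i. (\<lambda>v. v $ i) -` S i)" by auto
    ultimately show ?thesis by auto
  qed
  ultimately show ?thesis by (simp add: compact_eq_bounded_closed)
qed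

text \<open>Exhibits the generators of the projective product as a continuous image of a product of
  the factors, hence compact when the factors are.\<close>

lemma tensor_set_eq_vec_image:
  "{tensor x | x. \<forall>i. x i \<in> Q i} = (\<lambda>v. tensor (($) v)) ` {v. \<forall>i. v $ i \<in> Q i}"
proof -
  have "tensor x \<in> (\<lambda>v. tensor (($) v)) ` {v. \<forall>i. v $ i \<in> Q i}" if "\<forall>i. x i \<in> Q i" for x
    using that by (intro image_eqI[of _ _ "\<chi> i. x i"]) (auto simp: vec_lambda_inverse)
  then show ?thesis by auto
qed

lemma tensor_scaleR: "tensor (\<lambda>i. c i *\<^sub>R x i) = (\<Prod>i\<in>UNIV. c i) *\<^sub>R tensor x"
  by (simp add: tensor_def vec_eq_iff prod.distrib)

lemma subspace_tensor_space: "subspace (tensor_space D)"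
  by (simp add: tensor_space_def subspace_coord_space)

text \<open>Compactness passes from the generators to their convex hull, symmetry comes from
  negating one factor, and full dimension holds because every simple tensor is a multiple of a
  generator.\<close>

lemma proj_tensor_sym_bodies:
  fixes D :: "'l::finite \<Rightarrow> 'n::finite set"
  assumes Q: "\<And>i. Q i \<in> sym_bodies (coord_space (D i))"
  shows "proj_tensor Q \<in> sym_bodies (tensor_space D)"
proof (rule sym_bodiesI)
  let ?G = "{tensor x | x. \<forall>i. x i \<in> Q i}"
  have QE: "Q i \<subseteq> coord_space (D i)" and comp: "compact (Q i)" for i
    using Q[of i] by (auto simp: sym_bodies_def)
  have "?G \<subseteq> tensor_space D"
    using QE tensor_in_tensor_space by blast
  then show sub: "proj_tensor Q \<subseteq> tensor_space D"
    unfolding proj_tensor_def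
    by (intro hull_minimal) (auto simp: subspace_imp_convex subspace_tensor_space)
  show "compact (proj_tensor Q)"
    unfolding proj_tensor_def tensor_set_eq_vec_image
    by (intro compact_convex_hull compact_continuous_image continuous_on_tensor_vec_nth
        compact_vec_Collect comp)
  show "convex (proj_tensor Q)" by (simp add: proj_tensor_def)
  have neg: "- g \<in> ?G" if "g \<in> ?G" for g
  proof -
    obtain x where x: "g = tensor x" "\<And>i. x i \<in> Q i" using \<open>g \<in> ?G\<close> by auto
    \<comment> \<open>\<open>undefined\<close> is just some fixed index: exactly one factor changes
      sign, so the product of the \<open>c i\<close> is -1.\<close>
    define c where "c i = (if i = (undefined :: 'l) then -1 else 1::real)" for i
    have "- g = tensor (\<lambda>i. c i *\<^sub>R x i)"
      unfolding tensor_scaleR by (simp add: x(1) c_def)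
    moreover have "c i *\<^sub>R x i \<in> Q i" for i
      using x(2) sym_bodies_uminus[OF Q] by (simp add: c_def)
    ultimately show ?thesis by blast
  qed
  have "convex hull ?G \<subseteq> uminus ` (convex hull ?G)"
  proof (rule hull_minimal)
    show "?G \<subseteq> uminus ` (convex hull ?G)"
    proof
      fix g assume "g \<in> ?G"
      then have "- g \<in> convex hull ?G" using neg by (intro hull_inc)
      then show "g \<in> uminus ` (convex hull ?G)" by (intro image_eqI[of _ _ "- g"]) simp
    qed
    show "convex (uminus ` (convex hull ?G))"
      by (simp add: convex_negations)
  qed
  then show "- x \<in> proj_tensor Q" if "x \<in> proj_tensor Q" for x
    using that unfolding proj_tensor_def by force
  have "tensor (\<lambda>_. 0) \<in> ?G"
    using sym_bodies_0[OF subspace_coord_space Q] by blast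
  moreover have "tensor (\<lambda>_. 0 :: real ^ 'n) = (0 :: real ^ ('l \<Rightarrow> 'n))"
    by (simp add: tensor_def vec_eq_iff)
  ultimately have 0: "0 \<in> proj_tensor Q" by (simp add: proj_tensor_def hull_inc)
  then show "proj_tensor Q \<noteq> {}" by blast
  have "tensor x \<in> span (proj_tensor Q)" if x: "\<forall>i. x i \<in> coord_space (D i)" for x
  proof -
    have "\<exists>c>0. c *\<^sub>R x i \<in> Q i" for i
    proof -
      obtain r where r: "0 < r" "cball 0 r \<inter> coord_space (D i) \<subseteq> Q i"
        using sym_bodies_inner_ball[OF subspace_coord_space Q] .
      \<comment> \<open>Scales \<open>x i\<close> into the ball inside \<open>Q i\<close>; the
        \<open>+ 1\<close> covers \<open>x i = 0\<close>.\<close>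
      define c where "c = r / (norm (x i) + 1)"
      have c: "0 < c" using r by (simp add: c_def add_nonneg_pos)
      have "norm (x i) + 1 \<noteq> 0" using norm_ge_zero[of "x i"] by linarith
      then have "c * (norm (x i) + 1) = r" by (simp add: c_def)
      then have "c * norm (x i) \<le> r" using c by (simp add: distrib_left)
      then have "c *\<^sub>R x i \<in> cball 0 r \<inter> coord_space (D i)"
        using x c by (simp add: subspace_scale subspace_coord_space)
      then show ?thesis using r(2) c by blast
    qed
    then obtain c where c: "\<And>i. c i > 0" "\<And>i. c i *\<^sub>R x i \<in> Q i" by metis
    have "(\<Prod>i\<in>UNIV. c i) *\<^sub>R tensor x \<in> span (proj_tensor Q)"
      unfolding tensor_scaleR[symmetric] proj_tensor_def
      using c(2) by (intro span_base hull_inc) blast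
    then have "(1 / (\<Prod>i\<in>UNIV. c i)) *\<^sub>R (\<Prod>i\<in>UNIV. c i) *\<^sub>R tensor x \<in> span (proj_tensor Q)"
      by (rule span_scale)
    moreover have "(\<Prod>i\<in>UNIV. c i) \<noteq> 0" using c(1) by (simp add: less_imp_neq[symmetric])
    ultimately show ?thesis by simp
  qed
  then have "tensor_space D \<subseteq> span (proj_tensor Q)"
    unfolding span_tensor[symmetric] by (intro span_minimal) auto
  moreover have "span (proj_tensor Q) \<subseteq> tensor_space D"
    using sub subspace_tensor_space by (rule span_minimal)
  ultimately show "affine hull proj_tensor Q = tensor_space D"
    using affine_hull_span_0[OF hull_inc[OF 0]] by simp
qed

text \<open>The closed \<epsilon>-neighbourhood of a convex set is convex, being its Minkowski sum
  with a ball, so once it contains \<open>A\<close> it contains the hull of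
  \<open>A\<close>.\<close>

lemma convex_hull_near:
  fixes A B :: "'a::euclidean_space set"
  assumes "\<And>a. a \<in> A \<Longrightarrow> \<exists>b\<in>convex hull B. dist a b \<le> \<epsilon>" and "x \<in> convex hull A"
  shows "\<exists>y\<in>convex hull B. dist x y \<le> \<epsilon>"
proof -
  let ?N = "\<Union>y\<in>convex hull B. \<Union>z\<in>cball 0 \<epsilon>. {y + z}"
  have N: "x \<in> ?N \<longleftrightarrow> (\<exists>y\<in>convex hull B. dist x y \<le> \<epsilon>)" for x
  proof
    assume "\<exists>y\<in>convex hull B. dist x y \<le> \<epsilon>"
    then obtain y where "y \<in> convex hull B" "dist x y \<le> \<epsilon>" by blast
    then have "y \<in> convex hull B" "x - y \<in> cball 0 \<epsilon>" "x = y + (x - y)"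
      by (auto simp: dist_norm norm_minus_commute)
    then show "x \<in> ?N" unfolding UN_iff singleton_iff by blast
  next
    assume "x \<in> ?N"
    then obtain y z where "y \<in> convex hull B" "z \<in> cball 0 \<epsilon>" "x = y + z"
      unfolding UN_iff singleton_iff by blast
    then show "\<exists>y\<in>convex hull B. dist x y \<le> \<epsilon>"
      by (intro bexI[of _ y]) (auto simp: dist_norm)
  qed
  have "convex hull A \<subseteq> ?N"
  proof (rule hull_minimal)
    show "A \<subseteq> ?N" using assms(1) by (intro subsetI N[THEN iffD2])
    show "convex ?N"
      by (rule convex_sums) simp_all
  qed
  from N[THEN iffD1, OF subsetD[OF this assms(2)]] show ?thesis .
qed

text \<open>One half of a Hausdorff estimate, to be used in both directions. It suffices to
  approximate generators, which is done factor by factor; the second premise is the modulus of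
  continuity of \<open>tensor\<close>.\<close>

lemma proj_tensor_near:
  assumes "\<And>i x. x \<in> P i \<Longrightarrow> \<exists>y\<in>Q i. dist x y \<le> \<delta>"
    and "\<And>x y. \<lbrakk>\<And>i. x i \<in> P i; \<And>i. y i \<in> Q i; \<And>i. dist (x i) (y i) \<le> \<delta>\<rbrakk> \<Longrightarrow>
           dist (tensor x) (tensor y) \<le> \<epsilon>"
    and "p \<in> proj_tensor P"
  shows "\<exists>q\<in>proj_tensor Q. dist p q \<le> \<epsilon>"
  unfolding proj_tensor_def
proof (rule convex_hull_near)
  show "p \<in> convex hull {tensor x | x. \<forall>i. x i \<in> P i}"
    using assms(3) by (simp add: proj_tensor_def)
  fix a assume "a \<in> {tensor x | x. \<forall>i. x i \<in> P i}"
  then obtain x where x: "a = tensor x" "\<And>i. x i \<in> P i" by blast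
  have "\<forall>i. \<exists>y. y \<in> Q i \<and> dist (x i) y \<le> \<delta>" using assms(1)[OF x(2)] by blast
  then obtain y where y: "\<And>i. y i \<in> Q i" "\<And>i. dist (x i) (y i) \<le> \<delta>" by metis
  show "\<exists>b\<in>convex hull {tensor x | x. \<forall>i. x i \<in> Q i}. dist a b \<le> \<epsilon>"
    using assms(2)[OF x(2) y] y(1) x(1) by (blast intro: hull_inc)
qed

text \<open>Heine-Cantor on the compact product of balls of radius \<open>R\<close>.\<close>

lemma tensor_uniformly_continuous:
  assumes "0 < \<epsilon>"
  shows "\<exists>\<delta>>0. \<forall>x y :: 'l::finite \<Rightarrow> real ^ 'n::finite.
    (\<forall>i. norm (x i) \<le> R \<and> norm (y i) \<le> R \<and> dist (x i) (y i) \<le> \<delta>) \<longrightarrow>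
    dist (tensor x) (tensor y) < \<epsilon>"
proof -
  let ?K = "{v :: (real ^ 'n) ^ 'l. \<forall>i. v $ i \<in> cball 0 R}"
  have "compact ?K" by (rule compact_vec_Collect) simp
  then have "uniformly_continuous_on ?K (\<lambda>v. tensor (($) v))"
    by (intro compact_uniformly_continuous continuous_on_tensor_vec_nth)
  then obtain d where d: "0 < d"
    "\<And>v w. v \<in> ?K \<Longrightarrow> w \<in> ?K \<Longrightarrow> dist v w < d \<Longrightarrow> dist (tensor (($) v)) (tensor (($) w)) < \<epsilon>"
    using assms unfolding uniformly_continuous_on_def by (metis (no_types, lifting) dist_commute)
  \<comment> \<open>The distance of the packed vectors is at most the sum of \<open>CARD('l)\<close>
    factor distances, hence at most \<open>d / 2\<close>.\<close>
  define \<delta> where "\<delta> = d / (2 * CARD('l))"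
  show ?thesis
  proof (intro exI[of _ \<delta>] conjI allI impI)
    show "0 < \<delta>" using d by (simp add: \<delta>_def)
    fix x y :: "'l \<Rightarrow> real ^ 'n"
    assume *: "\<forall>i. norm (x i) \<le> R \<and> norm (y i) \<le> R \<and> dist (x i) (y i) \<le> \<delta>"
    have "dist (vec_lambda x) (vec_lambda y) \<le> (\<Sum>i\<in>UNIV. dist (x i) (y i))"
      using norm_le_sum_norm_vec_nth[of "vec_lambda x - vec_lambda y"] by (simp add: dist_norm)
    also have "\<dots> \<le> (\<Sum>i\<in>(UNIV::'l set). \<delta>)" using * by (intro sum_mono) simp
    also have "\<dots> < d" using d by (simp add: \<delta>_def)
    finally have "dist (vec_lambda x) (vec_lambda y) < d" .
    from d(2)[OF _ _ this] show "dist (tensor x) (tensor y) < \<epsilon>"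
      using * by (simp add: vec_lambda_inverse)
  qed
qed

lemma continuous_map_proj_tensor:
  fixes D :: "'l::finite \<Rightarrow> 'n::finite set"
  shows "continuous_map (product_topology (\<lambda>i. body_topology (coord_space (D i))) UNIV)
           (body_topology (tensor_space D)) proj_tensor"
    (is "continuous_map ?X _ _")
proof -
  interpret T: Metric_space "sym_bodies (tensor_space D)" "hausdorff (tensor_space D)"
    by (rule Metric_space_sym_bodies[OF subspace_tensor_space])
  interpret C: Metric_space "sym_bodies (coord_space (D i))" "hausdorff (coord_space (D i))" for i
    by (rule Metric_space_sym_bodies[OF subspace_coord_space])
  show ?thesis
    unfolding body_topology_def[of "tensor_space D"] T.continuous_map_to_metric
  proof (intro ballI allI impI)
    fix Q and \<epsilon> :: real assume "Q \<in> topspace ?X" and \<epsilon>: "0 < \<epsilon>"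
    then have Q: "\<And>i. Q i \<in> sym_bodies (coord_space (D i))"
      by (auto simp: topspace_body_topology subspace_coord_space)
    have "bounded (\<Union>i. Q i)"
      using Q by (intro bounded_UN) (auto simp: sym_bodies_def compact_imp_bounded)
    then obtain R where R: "\<And>i x. x \<in> Q i \<Longrightarrow> norm x \<le> R"
      by (auto simp: bounded_iff)
    \<comment> \<open>Radius \<open>R + 1\<close> also covers the perturbed bodies, which stay
      within distance 1 of the \<open>Q i\<close>. Half of \<epsilon> leaves room for the strict
      inequality defining the open ball.\<close>
    from tensor_uniformly_continuous[OF half_gt_zero[OF \<epsilon>], of "R + 1"]
    obtain d where d: "0 < d" "\<forall>x y :: 'l \<Rightarrow> real ^ 'n.
        (\<forall>i. norm (x i) \<le> R + 1 \<and> norm (y i) \<le> R + 1 \<and> dist (x i) (y i) \<le> d) \<longrightarrow>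
        dist (tensor x) (tensor y) < \<epsilon> / 2"
      by (elim exE conjE)
    define \<delta> where "\<delta> = min d 1"
    have \<delta>: "0 < \<delta>" "\<delta> \<le> d" "\<delta> \<le> 1" using d(1) by (auto simp: \<delta>_def)
    \<comment> \<open>A box of metric balls is open in the product topology because there are
      finitely many factors.\<close>
    let ?U = "PiE UNIV (\<lambda>i. C.mball i (Q i) \<delta>)"
    have "proj_tensor P \<in> T.mball (proj_tensor Q) \<epsilon>" if "P \<in> ?U" for P
    proof -
      have P: "P i \<in> sym_bodies (coord_space (D i))"
        and h: "hausdorff (coord_space (D i)) (Q i) (P i) \<le> \<delta>" for i
        using PiE_mem[OF that, of i] by auto
      note near = hausdorff_leD[OF subspace_coord_space Q P h]
      have RP: "norm x \<le> R + 1" if "x \<in> P i" for i x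
      proof -
        obtain y where "y \<in> Q i" "dist x y \<le> \<delta>" using near(2)[OF \<open>x \<in> P i\<close>] by blast
        then show ?thesis
          using R[of y i] \<delta>(3) norm_triangle_ineq2[of x y] by (simp add: dist_norm)
      qed
      have RQ: "norm x \<le> R + 1" if "x \<in> Q i" for i x using R[OF that] by simp
      have "hausdorff (tensor_space D) (proj_tensor Q) (proj_tensor P) \<le> \<epsilon> / 2"
      proof (rule hausdorff_leI)
        show "\<exists>q\<in>proj_tensor P. dist p q \<le> \<epsilon> / 2" if "p \<in> proj_tensor Q" for p
        proof (rule proj_tensor_near[OF near(1) _ that])
          show "dist (tensor x) (tensor y) \<le> \<epsilon> / 2"
            if "\<And>i. x i \<in> Q i" "\<And>i. y i \<in> P i" "\<And>i. dist (x i) (y i) \<le> \<delta>" for x y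
            by (rule less_imp_le[OF d(2)[rule_format]])
              (intro conjI RQ[OF that(1)] RP[OF that(2)] order_trans[OF that(3) \<delta>(2)])
        qed
        show "\<exists>q\<in>proj_tensor Q. dist p q \<le> \<epsilon> / 2" if "p \<in> proj_tensor P" for p
        proof (rule proj_tensor_near[OF near(2) _ that])
          show "dist (tensor x) (tensor y) \<le> \<epsilon> / 2"
            if "\<And>i. x i \<in> P i" "\<And>i. y i \<in> Q i" "\<And>i. dist (x i) (y i) \<le> \<delta>" for x y
            by (rule less_imp_le[OF d(2)[rule_format]])
              (intro conjI RP[OF that(1)] RQ[OF that(2)] order_trans[OF that(3) \<delta>(2)])
        qed
      qed (use P Q \<epsilon> proj_tensor_sym_bodies subspace_tensor_space in auto)
      then show ?thesis
        using \<epsilon> proj_tensor_sym_bodies[of P D] proj_tensor_sym_bodies[of Q D] P Q by simp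
    qed
    moreover have "openin ?X ?U"
      by (simp add: openin_PiE body_topology_def)
    moreover have "Q \<in> ?U" using Q \<delta>(1) by auto
    ultimately show "\<exists>U. openin ?X U \<and> Q \<in> U \<and> (\<forall>P\<in>U. proj_tensor P \<in> T.mball (proj_tensor Q) \<epsilon>)"
      by (intro exI[of _ ?U]) blast
  qed
qed

theorem proposition3p3:
  fixes D :: "'l::finite \<Rightarrow> 'n::finite set"
  assumes "2 \<le> CARD('l)"
    and "\<And>i. 2 \<le> card (D i)"
  shows "continuous_map
           (product_topology (\<lambda>i. body_topology (coord_space (D i))) UNIV)
           (body_topology (tensor_space D))
           proj_tensor \<and>
         continuous_map
           (product_topology (\<lambda>i. body_topology (coord_space (D i))) UNIV)
           (body_topology (tensor_space D))
           (inj_tensor D)"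
proof
  let ?X = "product_topology (\<lambda>i. body_topology (coord_space (D i))) UNIV"
  show "continuous_map ?X (body_topology (tensor_space D)) proj_tensor"
    by (rule continuous_map_proj_tensor)
  \<comment> \<open>Taking polars factorwise is continuous, since each component is a coordinate
    projection followed by a polar.\<close>
  have "continuous_map ?X ?X (\<lambda>Q i. polar_in (coord_space (D i)) (Q i))"
    unfolding continuous_map_componentwise_UNIV
  proof
    fix i
    show "continuous_map ?X (body_topology (coord_space (D i)))
            (\<lambda>Q. polar_in (coord_space (D i)) (Q i))"
    proof -
      have "continuous_map ?X (body_topology (coord_space (D i))) (\<lambda>Q. Q i)"
        by (rule continuous_map_product_projection) simp
      from continuous_map_compose[OF this continuous_map_polar_in[OF subspace_coord_space]]
      show ?thesis by (simp add: comp_def)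
    qed
  qed
  from continuous_map_compose[OF continuous_map_compose[OF this continuous_map_proj_tensor]
      continuous_map_polar_in[OF subspace_tensor_space]]
  show "continuous_map ?X (body_topology (tensor_space D)) (inj_tensor D)"
    by (simp add: inj_tensor_def[abs_def] comp_def)
qed

end
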